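(* Let $d\ge 2$, $n\ge d$ and $k\ge 1$ be integers. Then $D=\{0,1,\dots,\lceil n/(d^k+d^{k-1})\rceil-1\}$ is a distance $k$-dominating set of the generalized Kautz digraph $G_K(n,d)$, and consequently $$\gamma_k(G_K(n,d))\le \left\lceil \frac{n}{d^k+d^{k-1}}\right\rceil.$$
   Context: The generalized Kautz digraph $G_K(n,d)$ has vertex set $\{0,1,\dots,n-1\}$ and an arc $(x,y)$ whenever $y\equiv -dx-i \pmod n$ for some $1\le i\le d$ (self-loops allowed, no multiple arcs). A set $D$ of vertices of a digraph $G$ is a distance $k$-dominating set if every vertex $v\notin D$ has some $u\in D$ with a directed path from $u$ to $v$ of length at most $k$. $\gamma_k(G)$ denotes the minimum cardinality of a distance $k$-dominating set of $G$. *)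

theory Defs
  imports "Graph_Theory.Graph_Theory" "HOL-Number_Theory.Cong" Complex_Main
begin

text \<open>The congruence is taken over the integers, since its right-hand side is negative.
  Arcs form a set of pairs, so there are no multiple arcs; self-loops may occur.\<close>

definition gen_kautz :: "nat \<Rightarrow> nat \<Rightarrow> nat pair_pre_digraph" where
  "gen_kautz n d =
    \<lparr> pverts = {0..<n},
      parcs = {(x, y). x \<in> {0..<n} \<and> y \<in> {0..<n} \<and>
        (\<exists>i\<in>{1..d}. [int y = - int d * int x - int i] (mod int n))} \<rparr>"

definition distance_dominating_set :: "('a, 'b) pre_digraph \<Rightarrow> nat \<Rightarrow> 'a set \<Rightarrow> bool" where
  "distance_dominating_set G k D \<longleftrightarrow>
    D \<subseteq> verts G \<and>
    (\<forall>v\<in>verts G - D. \<exists>u\<in>D. \<exists>p. pre_digraph.apath G u p v \<and> length p \<le> k)"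

text \<open>Finiteness is required because an infinite set has \<open>card\<close> equal to \<open>0\<close>; it is
  automatic in a digraph with finitely many vertices, where the vertex set itself
  is a distance dominating set and so the minimum exists.\<close>

definition distance_domination_number :: "nat \<Rightarrow> ('a, 'b) pre_digraph \<Rightarrow> nat" where
  "distance_domination_number k G =
    (LEAST c. \<exists>D. finite D \<and> distance_dominating_set G k D \<and> card D = c)"

end

theory Submission
  imports Defs
begin

text \<open>Read vertices as integers modulo \<open>n\<close>. Out-neighbourhoods map intervals to intervals: the
  vertices reached by walks of length exactly \<open>j\<close> from \<open>[0, m)\<close> are the residues of
  \<open>[0, d\<^sup>j m)\<close> for even \<open>j\<close> and of \<open>[-d\<^sup>j m, 0)\<close> for odd \<open>j\<close>. For \<open>j = k - 1\<close> and \<open>j = k\<close>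
  these two intervals are adjacent, and together they contain \<open>(d\<^sup>k + d\<^bsup>k-1\<^esup>) m \<ge> n\<close>
  consecutive integers, hence every residue.\<close>

text \<open>Each unfolding of \<open>awalk_to_apath\<close> cuts a cycle out of the walk, so the
  length never grows.\<close>

lemma (in wf_digraph) length_awalk_to_apath_le:
  assumes "awalk u p v"
  shows "length (awalk_to_apath p) \<le> length p"
  using assms
proof (induct rule: awalk_to_apath_induct)
  case (path p)
  then have "awalk_to_apath p = p"
    by (auto simp: awalk_to_apath.simps)
  then show ?case by simp
next
  case (decomp p q r s)
  then have "p = q @ r @ s"
    by (auto elim!: awalk_cyc_decompE)
  with decomp step_awalk_to_apath[of u p v q r s] show ?case by simp
qed

text \<open>The definition asks for paths, but the interval argument produces walks that may repeat
  vertices; cutting out cycles closes the gap.\<close>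

lemma distance_dominating_set_awalkI:
  assumes "wf_digraph G" "D \<subseteq> verts G"
    and "\<And>v. v \<in> verts G \<Longrightarrow> \<exists>u\<in>D. \<exists>p. pre_digraph.awalk G u p v \<and> length p \<le> k"
  shows "distance_dominating_set G k D"
proof -
  interpret wf_digraph G by fact
  have "\<exists>u\<in>D. \<exists>p. apath u p v \<and> length p \<le> k" if "v \<in> verts G" for v
    using assms(3)[OF that] apath_awalk_to_apath length_awalk_to_apath_le
    by (meson order_trans)
  with assms(2) show ?thesis
    by (auto simp: distance_dominating_set_def)
qed

lemma distance_domination_number_le:
  assumes "finite D" "distance_dominating_set G k D"
  shows "distance_domination_number k G \<le> card D"
  unfolding distance_domination_number_def
  using assms by (intro Least_le) blast

lemma verts_gen_kautz: "pverts (gen_kautz n d) = {0..<n}"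
  by (simp add: gen_kautz_def)

lemma wf_digraph_gen_kautz: "wf_digraph (with_proj (gen_kautz n d))"
  by unfold_locales (auto simp: gen_kautz_def)

definition walk_interval :: "nat \<Rightarrow> nat \<Rightarrow> nat \<Rightarrow> int set" where
  "walk_interval d m j = (if even j then {0..<int (d ^ j * m)} else {- int (d ^ j * m)..<0})"

text \<open>The out-neighbours of \<open>w\<close>, before reduction modulo \<open>n\<close>, are
  the block from \<open>-d*(w+1)\<close> to \<open>-d*w-1\<close>. These blocks tile the integers,
  and the one containing \<open>z\<close> has \<open>z div d = -w-1\<close>.\<close>

lemma walk_interval_Suc_pred:
  assumes "d > 0" "z \<in> walk_interval d m (Suc j)"
  shows "- (z div int d) - 1 \<in> walk_interval d m j"
proof -
  define M where "M = int (d ^ j * m)"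
  have M: "int (d ^ Suc j * m) = M * int d"
    by (simp add: M_def)
  have d: "int d > 0" using assms(1) by simp
  \<comment> \<open>This is the sign criterion for \<open>div\<close> applied to
    \<open>z - x * d\<close>, whose quotient is \<open>z div d - x\<close>.\<close>
  have le: "x \<le> z div int d \<longleftrightarrow> x * int d \<le> z" for x
    using pos_imp_zdiv_nonneg_iff[OF d, of "z + (- x) * int d"] d
    by (simp only: div_mult_self1) auto
  have less: "z div int d < x \<longleftrightarrow> z < x * int d" for x
    using le[of x] by linarith
  have "z \<in> (if even j then {- (M * int d)..<0} else {0..<M * int d})"
    using assms(2) unfolding walk_interval_def M by (cases "even j") simp_all
  \<comment> \<open>The reflection \<open>q \<mapsto> -q-1\<close> swaps \<open>[0, M)\<close> and
    \<open>[-M, 0)\<close>, so only the bounds \<open>0\<close>, \<open>M\<close> and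
    \<open>-M\<close> on the quotient matter.\<close>
  then show ?thesis
    using le[of 0] le[of "- M"] less[of 0] less[of M]
    unfolding walk_interval_def M_def[symmetric] by (auto split: if_splits)
qed

lemma gen_kautz_arc_mod:
  assumes "d > 0" "n > 0"
  shows "(nat ((- (z div int d) - 1) mod int n), nat (z mod int n)) \<in> parcs (gen_kautz n d)"
proof -
  define w where "w = - (z div int d) - 1"
  \<comment> \<open>Remainders \<open>0..d-1\<close> become offsets \<open>d..1\<close>, which is
    why \<open>w\<close> carries the extra \<open>-1\<close>.\<close>
  define i where "i = d - nat (z mod int d)"
  have r: "0 \<le> z mod int d" "z mod int d < int d"
    using assms(1) by simp_all
  then have i: "i \<in> {1..d}" "int i = int d - z mod int d"
    unfolding i_def by (auto simp: of_nat_diff nat_less_iff le_diff_conv)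
  have "z = int d * (z div int d) + z mod int d"
    by simp
  then have z: "z = - int d * w - int i"
    unfolding i(2) w_def by (simp add: algebra_simps)
  have "[- int d * w - int i = - int d * (w mod int n) - int i] (mod int n)"
    by (intro cong_diff cong_mult cong_refl) (simp add: cong_def)
  then have "[z mod int n = - int d * (w mod int n) - int i] (mod int n)"
    unfolding z[symmetric] by (simp add: cong_def)
  with i(1) assms(2) show ?thesis
    unfolding w_def[symmetric] by (auto simp: gen_kautz_def nat_less_iff)
qed

text \<open>Induction on the length: a walk to the predecessor of \<open>z\<close> is extended by
  one final arc. For length 0, \<open>m \<le> n\<close> makes \<open>z\<close> its own
  residue.\<close>

lemma gen_kautz_walk_interval:
  assumes "d > 0" "n > 0" "m \<le> n" "z \<in> walk_interval d m j"
  shows "\<exists>u\<in>{0..<m}. \<exists>p. pre_digraph.awalk (with_proj (gen_kautz n d)) u p (nat (z mod int n))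
    \<and> length p = j"
  using assms(4)
proof (induction j arbitrary: z)
  case 0
  interpret wf_digraph "with_proj (gen_kautz n d)" by (rule wf_digraph_gen_kautz)
  from 0 assms(3) have "nat z < m" "nat (z mod int n) = nat z"
    by (auto simp: walk_interval_def)
  with assms(3) show ?case
    by (intro bexI[of _ "nat z"] exI[of _ "[]"]) (auto simp: awalk_Nil_iff verts_gen_kautz)
next
  case (Suc j)
  interpret wf_digraph "with_proj (gen_kautz n d)" by (rule wf_digraph_gen_kautz)
  let ?w = "nat ((- (z div int d) - 1) mod int n)"
  let ?e = "(?w, nat (z mod int n))"
  from Suc.IH[OF walk_interval_Suc_pred[OF assms(1) Suc.prems]]
  obtain u p where "u \<in> {0..<m}" "awalk u p ?w" "length p = j"
    by blast
  moreover have "awalk ?w [?e] (nat (z mod int n))"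
    using arc_implies_awalk[of ?e] gen_kautz_arc_mod[OF assms(1,2)] by simp
  ultimately show ?case
    by (intro bexI[of _ u] exI[of _ "p @ [?e]"]) (auto intro: awalk_appendI)
qed

lemma walk_intervals_cover_residues:
  assumes "k \<ge> 1" "n \<le> (d ^ k + d ^ (k - 1)) * m" "v < n"
  shows "\<exists>j\<le>k. \<exists>z\<in>walk_interval d m j. nat (z mod int n) = v"
proof -
  obtain l where k: "k = Suc l" using assms(1) by (cases k) auto
  define a b where "a = int (d ^ l * m)" and "b = int (d ^ k * m)"
  have n: "int n \<le> a + b"
    using assms(2) unfolding a_def b_def k
    by (metis add.commute add_mult_distrib diff_Suc_1 of_nat_add of_nat_mono)
  have v: "nat (int v mod int n) = v" "nat ((int v - int n) mod int n) = v"
    using assms(3) by (simp_all add: mod_simps)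
  have W: "walk_interval d m l = (if even l then {0..<a} else {-a..<0})"
    "walk_interval d m k = (if even l then {-b..<0} else {0..<b})"
    by (simp_all add: walk_interval_def a_def b_def k)
  \<comment> \<open>The union is \<open>[-b, a)\<close> or \<open>[-a, b)\<close>. If
    \<open>v\<close> lies beyond the right end, then \<open>v - n\<close> is negative and, by
    \<open>n \<le> a + b\<close>, not below the left end.\<close>
  have "int v \<in> walk_interval d m l \<union> walk_interval d m k
      \<or> int v - int n \<in> walk_interval d m l \<union> walk_interval d m k"
    using n assms(3) by (auto simp: W)
  moreover have "l \<le> k" by (simp add: k)
  ultimately show ?thesis using v by blast
qed

theorem theorem3p1:
  fixes d n k :: nat
  assumes "d \<ge> 2" and "n \<ge> d" and "k \<ge> 1"
  shows "distance_dominating_set (with_proj (gen_kautz n d)) k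
      {0..<nat \<lceil>real n / real (d ^ k + d ^ (k - 1))\<rceil>}
    \<and> int (distance_domination_number k (with_proj (gen_kautz n d)))
      \<le> \<lceil>real n / real (d ^ k + d ^ (k - 1))\<rceil>"
proof -
  define c where "c = d ^ k + d ^ (k - 1)"
  define m where "m = nat \<lceil>real n / real c\<rceil>"
  have c: "c \<ge> 1" using assms(1) by (simp add: c_def Suc_le_eq)
  have "real n / real c \<ge> 0" by simp
  then have ceil: "int m = \<lceil>real n / real c\<rceil>"
    unfolding m_def by linarith
  have "real n / real c \<le> real m"
    unfolding m_def by (rule real_nat_ceiling_ge)
  then have "real n \<le> real (c * m)"
    using c by (simp add: field_simps)
  then have cover: "n \<le> c * m" by linarith
  \<comment> \<open>This bound keeps the candidate set inside the vertex set.\<close>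
  have "real n / real c \<le> real n"
    using c divide_left_mono[of 1 "real c" "real n"] by simp
  then have m_le: "m \<le> n"
    unfolding m_def by (simp add: ceiling_le_iff)
  have dom: "distance_dominating_set (with_proj (gen_kautz n d)) k {0..<m}"
  proof (rule distance_dominating_set_awalkI[OF wf_digraph_gen_kautz])
    show "{0..<m} \<subseteq> verts (with_proj (gen_kautz n d))"
      using m_le by (auto simp: verts_gen_kautz)
    fix v assume "v \<in> verts (with_proj (gen_kautz n d))"
    then have "v < n" by (simp add: verts_gen_kautz)
    with walk_intervals_cover_residues[OF assms(3) cover[unfolded c_def]]
    obtain j z where "j \<le> k" "z \<in> walk_interval d m j" "nat (z mod int n) = v"
      by blast
    with gen_kautz_walk_interval[of d n m z j] m_le assms
    show "\<exists>u\<in>{0..<m}. \<exists>p. pre_digraph.awalk (with_proj (gen_kautz n d)) u p v \<and> length p \<le> k"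
      by auto
  qed
  have "distance_domination_number k (with_proj (gen_kautz n d)) \<le> m"
    using distance_domination_number_le[OF _ dom] by simp
  then have "int (distance_domination_number k (with_proj (gen_kautz n d))) \<le> \<lceil>real n / real c\<rceil>"
    unfolding ceil[symmetric] by (rule of_nat_mono)
  with dom show ?thesis
    unfolding m_def c_def by blast
qed

end
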